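(* Let $T$ be a set and let $\Xi_{\max}(T),\Xi_{\lim}(T),\Xi_{\mathrm{bin}}(T)$ be the sets of functions on $T\times T$ defined in the context. Then: a) $\Xi_{\mathrm{bin}}(T)\subset\Xi_{\max}(T)\subset\Xi_{\lim}(T)$. b) $\Xi_{\lim}(T)=\mathrm{closure}(\Xi_{\mathrm{bin}}(T))=\mathrm{closure}(\Xi_{\max}(T))$, where the closure is with respect to pointwise convergence. c) If $T$ is a separable metric space, then additionally $\{\chi\in\Xi_{\max}(T):\chi\text{ continuous}\}=\{\chi\in\Xi_{\lim}(T):\chi\text{ continuous}\}$.
   Context: A random field $X=\{X_t\}_{t\in T}$ has standard Fréchet marginals if $\mathbb P(X_t\le x)=e^{-1/x}$ for all $t\in T$, $x\ge 0$ (value $0$ at $x=0$). Such a field is max-stable if for every $n\ge1$ and independent copies $X^{(1)},\dots,X^{(n)}$ of $X$ the field $n^{-1}\max_{i}X^{(i)}$ has the same (finite-dimensional) distributions as $X$. $\Xi_{\max}(T)$ is the set of all functions $(s,t)\mapsto\chi(s,t)=\lim_{x\uparrow\infty}\mathbb P(X_s\ge x\mid X_t\ge x)$ on $T\times T$, where $X$ is a max-stable random field on $T$ with standard Fréchet marginals. $\Xi_{\lim}(T)$ is the set of all functions $(s,t)\mapsto\lim_{x\uparrow\infty}\mathbb P(Z_s\ge x\mid Z_t\ge x)$, where $Z$ is a real-valued random field on $T$ whose one-dimensional marginal distributions are all the same and have upper endpoint $\infty$ (i.e. $\mathbb P(Z_t>x)>0$ for all $x\in\mathbb R$), such that these limits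 exist for all $s,t\in T$. $\Xi_{\mathrm{bin}}(T)$ is the set of all functions $(s,t)\mapsto\mathbb P(Y_s=1\mid Y_t=1)$, where $Y$ is a random field on $T$ with values in $\{0,1\}$ whose one-dimensional marginal distributions are all the same, with $\mathbb E Y_t\ne0$. *)

theory Defs
  imports "HOL-Probability.Probability"
begin

text \<open>
  A random field on an index set \<open>T :: 't set\<close> is a family \<open>X :: 't \<Rightarrow> 'w \<Rightarrow> real\<close> of random
  variables on a probability space \<open>M :: 'w measure\<close>; values of \<open>X\<close> outside \<open>T\<close> are irrelevant.
\<close>

definition random_field :: "'t set \<Rightarrow> 'w measure \<Rightarrow> ('t \<Rightarrow> 'w \<Rightarrow> real) \<Rightarrow> bool" where
  "random_field T M X \<longleftrightarrow> prob_space M \<and> (\<forall>t\<in>T. X t \<in> borel_measurable M)"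

definition fdd :: "'t set \<Rightarrow> 'w measure \<Rightarrow> ('t \<Rightarrow> 'w \<Rightarrow> real) \<Rightarrow> ('t \<Rightarrow> real) measure" where
  "fdd J M X = distr M (\<Pi>\<^sub>M t\<in>J. borel) (\<lambda>\<omega>. \<lambda>t\<in>J. X t \<omega>)"

definition same_fdds ::
  "'t set \<Rightarrow> 'v measure \<Rightarrow> ('t \<Rightarrow> 'v \<Rightarrow> real) \<Rightarrow> 'w measure \<Rightarrow> ('t \<Rightarrow> 'w \<Rightarrow> real) \<Rightarrow> bool" where
  "same_fdds T N Y M X \<longleftrightarrow> (\<forall>J. finite J \<and> J \<subseteq> T \<longrightarrow> fdd J N Y = fdd J M X)"

definition identical_marginals :: "'t set \<Rightarrow> 'w measure \<Rightarrow> ('t \<Rightarrow> 'w \<Rightarrow> real) \<Rightarrow> bool" where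
  "identical_marginals T M X \<longleftrightarrow> (\<forall>s\<in>T. \<forall>t\<in>T. distr M borel (X s) = distr M borel (X t))"

text \<open>The case \<open>x = 0\<close> is separate because \<open>exp (- 1 / 0) = 1\<close> in HOL.\<close>

definition standard_Frechet :: "'t set \<Rightarrow> 'w measure \<Rightarrow> ('t \<Rightarrow> 'w \<Rightarrow> real) \<Rightarrow> bool" where
  "standard_Frechet T M X \<longleftrightarrow>
     (\<forall>t\<in>T. \<forall>x\<ge>0. \<P>(\<omega> in M. X t \<omega> \<le> x) = (if x = 0 then 0 else exp (- 1 / x)))"

text \<open>
  \<open>n\<close> fields on a common probability space \<open>N\<close>, each distributed like \<open>X\<close>, and jointly
  independent as random elements of the path space.
\<close>

definition independent_copies ::
  "'t set \<Rightarrow> 'w measure \<Rightarrow> ('t \<Rightarrow> 'w \<Rightarrow> real) \<Rightarrow> nat \<Rightarrow> 'v measure \<Rightarrow> (nat \<Rightarrow> 't \<Rightarrow> 'v \<Rightarrow> real) \<Rightarrow> bool"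
where
  "independent_copies T M X n N X' \<longleftrightarrow>
     (\<forall>i<n. random_field T N (X' i) \<and> same_fdds T N (X' i) M X) \<and>
     prob_space.indep_vars N (\<lambda>i. \<Pi>\<^sub>M t\<in>T. borel) (\<lambda>i \<omega>. \<lambda>t\<in>T. X' i t \<omega>) {..<n}"

text \<open>
  The probability spaces carrying the copies range over all those of type \<open>(nat \<Rightarrow> 'w) measure\<close>.
  The law of the maximum does not depend on the choice of the copies, and copies exist on the
  product space \<open>\<Pi>\<^sub>M i\<in>{..<n}. M\<close>, which has this type; so fixing the type is no restriction.
\<close>

definition max_stable :: "'t set \<Rightarrow> 'w measure \<Rightarrow> ('t \<Rightarrow> 'w \<Rightarrow> real) \<Rightarrow> bool" where
  "max_stable T M X \<longleftrightarrow>
     (\<forall>n\<ge>1. \<forall>(N :: (nat \<Rightarrow> 'w) measure) X'. independent_copies T M X n N X' \<longrightarrow>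
        same_fdds T N (\<lambda>t \<omega>. (MAX i\<in>{..<n}. X' i t \<omega>) / real n) M X)"

definition tail_dependence :: "'w measure \<Rightarrow> ('t \<Rightarrow> 'w \<Rightarrow> real) \<Rightarrow> 't \<times> 't \<Rightarrow> real" where
  "tail_dependence M X = (\<lambda>(s, t). Lim at_top (\<lambda>x. \<P>(\<omega> in M. X s \<omega> \<ge> x \<bar> X t \<omega> \<ge> x)))"

definition tail_dependence_exists :: "'t set \<Rightarrow> 'w measure \<Rightarrow> ('t \<Rightarrow> 'w \<Rightarrow> real) \<Rightarrow> bool" where
  "tail_dependence_exists T M X \<longleftrightarrow>
     (\<forall>s\<in>T. \<forall>t\<in>T. \<exists>l. ((\<lambda>x. \<P>(\<omega> in M. X s \<omega> \<ge> x \<bar> X t \<omega> \<ge> x)) \<longlongrightarrow> l) at_top)"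

text \<open>
  Functions on \<open>T \<times> T\<close> are represented by their extensional versions. In the three sets below the
  sample space is any probability space of type \<open>('t \<Rightarrow> real) measure\<close>. All properties involved
  depend only on the finite-dimensional distributions of the field, and every random field on \<open>T\<close>
  has the same ones as the coordinate field on path space under its own law, which has this type;
  so fixing the type is no restriction.

  In \<open>Xi_max\<close> the existence of the limits is not part of the definition.
\<close>

definition Xi_max :: "'t set \<Rightarrow> ('t \<times> 't \<Rightarrow> real) set" where
  "Xi_max T = {restrict (tail_dependence M X) (T \<times> T) |
     (M :: ('t \<Rightarrow> real) measure) X.
       random_field T M X \<and> standard_Frechet T M X \<and> max_stable T M X}"

definition Xi_lim :: "'t set \<Rightarrow> ('t \<times> 't \<Rightarrow> real) set" where
  "Xi_lim T = {restrict (tail_dependence M Z) (T \<times> T) |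
     (M :: ('t \<Rightarrow> real) measure) Z.
       random_field T M Z \<and> identical_marginals T M Z \<and>
       (\<forall>t\<in>T. \<forall>x. \<P>(\<omega> in M. Z t \<omega> > x) > 0) \<and>
       tail_dependence_exists T M Z}"

definition Xi_bin :: "'t set \<Rightarrow> ('t \<times> 't \<Rightarrow> real) set" where
  "Xi_bin T = {\<lambda>(s, t)\<in>T \<times> T. \<P>(\<omega> in M. Y s \<omega> = 1 \<bar> Y t \<omega> = 1) |
     (M :: ('t \<Rightarrow> real) measure) Y.
       random_field T M Y \<and> (\<forall>t\<in>T. \<forall>\<omega>\<in>space M. Y t \<omega> \<in> {0, 1}) \<and>
       identical_marginals T M Y \<and> (\<forall>t\<in>T. prob_space.expectation M (Y t) \<noteq> 0)}"

abbreviation pointwise_closure :: "'t set \<Rightarrow> ('t \<times> 't \<Rightarrow> real) set \<Rightarrow> ('t \<times> 't \<Rightarrow> real) set" where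
  "pointwise_closure T A \<equiv> product_topology (\<lambda>_. euclideanreal) (T \<times> T) closure_of A"

end

theory Submission
  imports Defs "HOL-Real_Asymp.Real_Asymp"
begin

text \<open>
  All three assertions follow from \<open>Xi_max T = Xi_lim T = closure of Xi_bin T\<close>. Exceedance fields
  \<open>1{Z \<ge> x}\<close> show that \<open>Xi_lim T\<close> lies in the closure, and max-stability forces bivariate laws
  \<open>P(X s \<le> x, X t \<le> x) = exp (- \<theta> / x)\<close>, so that \<open>Xi_max T\<close> lies in \<open>Xi_lim T\<close>. For the closure
  being contained in \<open>Xi_max T\<close>, a binary field is encoded by the weights
  \<open>m (J, B) = P(on J, Y is 1 exactly on B) / P(Y = 1)\<close> for finite \<open>J\<close> and nonempty \<open>B \<subseteq> J\<close>. These
  lie in \<open>[0, 1]\<close> and satisfy linear consistency conditions, so by Tychonoff they range in a compact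
  set, whose image in the functions on \<open>T \<times> T\<close> is closed. Each consistent system of weights yields a
  max-stable field with the right tail dependence (the Tawn-Molchanov model): its finite-dimensional
  laws are those of \<open>X t = max over A containing t of m (J, A) * F A\<close> with independent Frechet
  variables \<open>F A\<close>, and the Kolmogorov extension theorem glues them together.
\<close>

section \<open>Finite-dimensional distributions and independent copies\<close>

text \<open>Lower orthants are stable under intersection, generate the product sigma-algebra and
  exhaust the space, so the pi-lambda argument for uniqueness of measures applies.\<close>

lemma measure_eqI_PiM_atMost:
  fixes P Q :: "('t \<Rightarrow> real) measure"
  assumes J: "finite J" and P: "prob_space P" and Q: "prob_space Q"
    and sP: "sets P = sets (\<Pi>\<^sub>M t\<in>J. borel)" and sQ: "sets Q = sets (\<Pi>\<^sub>M t\<in>J. borel)"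
    and eq: "\<And>a. \<P>(f in P. \<forall>t\<in>J. f t \<le> a t) = \<P>(f in Q. \<forall>t\<in>J. f t \<le> a t)"
  shows "P = Q"
proof -
  interpret P: prob_space P by fact
  interpret Q: prob_space Q by fact
  define \<Omega> where "\<Omega> = (\<Pi>\<^sub>E t\<in>J. UNIV :: real set)"
  define box where "box a = {f\<in>\<Omega>. \<forall>t\<in>J. f t \<le> a t}" for a :: "'t \<Rightarrow> real"
  have "sets (\<Pi>\<^sub>M t\<in>J. borel :: real measure) = sets (\<Pi>\<^sub>M t\<in>J. sigma UNIV (range atMost))"
    by (simp add: borel_eq_atMost)
  \<comment> \<open>\<open>sets_PiM_sigma\<close> works with a cover of the index set by finite sets
    \<open>j\<close>. As \<open>J\<close> is finite, the one-member cover \<open>{J}\<close> serves,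
    and every generator is a full box.\<close>
  also have "\<dots> = sets (sigma \<Omega> {{f\<in>\<Omega>. \<forall>i\<in>j. f i \<in> A i} | A j. j \<in> {J} \<and> A \<in> Pi j (\<lambda>_. range atMost)})"
    unfolding \<Omega>_def
  proof (rule sets_PiM_sigma)
    fix i :: 't
    have "UNIV = (\<Union>n::nat. {..real n})"
      by (auto intro: real_arch_simple)
    then show "\<exists>S\<subseteq>range atMost. countable S \<and> UNIV = \<Union>(S :: real set set)"
      by (intro exI[of _ "range (\<lambda>n::nat. {..real n})"]) auto
  qed (use J in auto)
  also have "{{f\<in>\<Omega>. \<forall>i\<in>j. f i \<in> A i} | A j. j \<in> {J} \<and> A \<in> Pi j (\<lambda>_. range atMost)} = range box"
  proof safe
    fix A :: "'t \<Rightarrow> real set" assume "A \<in> Pi J (\<lambda>_. range atMost)"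
    then have "\<forall>i\<in>J. \<exists>a. A i = {..a}" by (auto simp: Pi_iff)
    then obtain a where "\<forall>i\<in>J. A i = {..a i}" by metis
    then show "{f\<in>\<Omega>. \<forall>i\<in>J. f i \<in> A i} \<in> range box"
      by (intro image_eqI[of _ _ a]) (auto simp: box_def)
  next
    fix a show "\<exists>A j. box a = {f\<in>\<Omega>. \<forall>i\<in>j. f i \<in> A i} \<and> j \<in> {J} \<and> A \<in> Pi j (\<lambda>_. range atMost)"
      by (intro exI[of _ "\<lambda>i. {..a i}"] exI[of _ J]) (auto simp: box_def)
  qed
  finally have gen: "sets (\<Pi>\<^sub>M t\<in>J. borel :: real measure) = sigma_sets \<Omega> (range box)"
    by (subst (asm) sets_measure_of) (auto simp: box_def)
  have sp: "space P = \<Omega>" "space Q = \<Omega>"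
    using sets_eq_imp_space_eq[OF sP] sets_eq_imp_space_eq[OF sQ] by (auto simp: \<Omega>_def space_PiM)
  show ?thesis
  proof (rule measure_eqI_generator_eq)
    show "Int_stable (range box)"
    proof (safe intro!: Int_stableI)
      fix a b show "box a \<inter> box b \<in> range box"
        by (intro image_eqI[of _ _ "\<lambda>t. min (a t) (b t)"]) (auto simp: box_def)
    qed
    show "range box \<subseteq> Pow \<Omega>" by (auto simp: box_def)
    show "emeasure P X = emeasure Q X" if "X \<in> range box" for X
      using that eq by (auto simp: P.emeasure_eq_measure Q.emeasure_eq_measure box_def sp)
    show "range (\<lambda>n::nat. box (\<lambda>_. real n)) \<subseteq> range box" by auto
    show "(\<Union>n::nat. box (\<lambda>_. real n)) = \<Omega>"
    proof safe
      fix f assume "f \<in> \<Omega>"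
      \<comment> \<open>Inserting 0 keeps the set under \<open>Max\<close> nonempty when
        \<open>J\<close> is empty.\<close>
      obtain n :: nat where "Max (insert 0 (f ` J)) \<le> real n"
        using real_arch_simple by blast
      then have "f t \<le> real n" if "t \<in> J" for t
        using that J by (subst (asm) Max_le_iff) auto
      with \<open>f \<in> \<Omega>\<close> show "f \<in> (\<Union>n::nat. box (\<lambda>_. real n))" by (auto simp: box_def)
    qed (auto simp: box_def)
  qed (auto simp: sP sQ gen)
qed

lemma sets_Collect_le_finite:
  fixes X :: "'t \<Rightarrow> 'w \<Rightarrow> real"
  assumes "random_field T M X" "finite K" "K \<subseteq> T"
  shows "{\<omega>\<in>space M. \<forall>t\<in>K. X t \<omega> \<le> a t} \<in> sets M"
proof (rule sets.sets_Collect_finite_All)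
  fix t assume "t \<in> K"
  then have [measurable]: "X t \<in> borel_measurable M"
    using assms by (auto simp: random_field_def)
  show "{\<omega>\<in>space M. X t \<omega> \<le> a t} \<in> sets M" by measurable
qed fact

lemma measurable_restrict_field:
  assumes "random_field T M X" "K \<subseteq> T"
  shows "(\<lambda>\<omega>. \<lambda>t\<in>K. X t \<omega>) \<in> measurable M (\<Pi>\<^sub>M t\<in>K. borel)"
  using assms by (intro measurable_restrict) (auto simp: random_field_def)

lemma prob_space_fdd:
  assumes "random_field T M X" "K \<subseteq> T"
  shows "prob_space (fdd K M X)"
  unfolding fdd_def using assms
  by (intro prob_space.prob_space_distr measurable_restrict_field) (auto simp: random_field_def)

lemma sets_PiM_Collect_le_finite:
  assumes "finite K" "K \<subseteq> J"
  shows "{f\<in>space (\<Pi>\<^sub>M t\<in>J. borel). \<forall>t\<in>K. f t \<le> (a t :: real)} \<in> sets (\<Pi>\<^sub>M t\<in>J. borel)"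
proof (rule sets.sets_Collect_finite_All)
  fix t assume "t \<in> K"
  then have [measurable]: "t \<in> J" using assms by auto
  show "{f\<in>space (\<Pi>\<^sub>M t\<in>J. borel). f t \<le> a t} \<in> sets (\<Pi>\<^sub>M t\<in>J. borel)" by measurable
qed fact

lemma prob_fdd_le:
  assumes "random_field T M X" "J \<subseteq> T" "finite K" "K \<subseteq> J"
  shows "\<P>(f in fdd J M X. \<forall>t\<in>K. f t \<le> a t) = \<P>(\<omega> in M. \<forall>t\<in>K. X t \<omega> \<le> a t)"
proof -
  have "\<P>(f in fdd J M X. \<forall>t\<in>K. f t \<le> a t) =
      measure M ((\<lambda>\<omega>. \<lambda>t\<in>J. X t \<omega>) -` {f\<in>space (\<Pi>\<^sub>M t\<in>J. borel). \<forall>t\<in>K. f t \<le> a t} \<inter> space M)"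
    unfolding fdd_def using assms measurable_restrict_field[OF assms(1,2)] sets_PiM_Collect_le_finite[OF assms(3,4)]
    by (subst measure_distr[symmetric]) auto
  also have "(\<lambda>\<omega>. \<lambda>t\<in>J. X t \<omega>) -` {f\<in>space (\<Pi>\<^sub>M t\<in>J. borel). \<forall>t\<in>K. f t \<le> a t} \<inter> space M
    = {\<omega>\<in>space M. \<forall>t\<in>K. X t \<omega> \<le> a t}"
    using assms by (auto simp: space_PiM)
  finally show ?thesis .
qed

text \<open>If some corner \<open>a t\<close> is at most 0, both orthant probabilities vanish by
  \<open>X0\<close> and \<open>Y0\<close>, so positive corners decide the law. This suits exponent
  functions, which are prescribed at positive arguments only.\<close>

lemma fdd_eqI_positive:
  fixes X :: "'t \<Rightarrow> 'w \<Rightarrow> real" and Y :: "'t \<Rightarrow> 'v \<Rightarrow> real"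
  assumes X: "random_field J M X" and Y: "random_field J N Y" and J: "finite J"
    and X0: "\<And>t. t \<in> J \<Longrightarrow> \<P>(\<omega> in M. X t \<omega> \<le> 0) = 0"
    and Y0: "\<And>t. t \<in> J \<Longrightarrow> \<P>(\<omega> in N. Y t \<omega> \<le> 0) = 0"
    and eq: "\<And>a. (\<And>t. t \<in> J \<Longrightarrow> 0 < a t) \<Longrightarrow>
      \<P>(\<omega> in M. \<forall>t\<in>J. X t \<omega> \<le> a t) = \<P>(\<omega> in N. \<forall>t\<in>J. Y t \<omega> \<le> a t)"
  shows "fdd J M X = fdd J N Y"
proof (rule measure_eqI_PiM_atMost[OF J])
  interpret M: prob_space M using X by (simp add: random_field_def)
  interpret N: prob_space N using Y by (simp add: random_field_def)
  show "prob_space (fdd J M X)" "prob_space (fdd J N Y)"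
    using X Y by (auto intro: prob_space_fdd)
  show "sets (fdd J M X) = sets (\<Pi>\<^sub>M t\<in>J. borel)" "sets (fdd J N Y) = sets (\<Pi>\<^sub>M t\<in>J. borel)"
    by (auto simp: fdd_def)
  fix a :: "'t \<Rightarrow> real"
  have "\<P>(\<omega> in M. \<forall>t\<in>J. X t \<omega> \<le> a t) = \<P>(\<omega> in N. \<forall>t\<in>J. Y t \<omega> \<le> a t)"
  proof (cases "\<forall>t\<in>J. 0 < a t")
    case True then show ?thesis by (intro eq) auto
  next
    case False
    then obtain t where t: "t \<in> J" "a t \<le> 0" by force
    have "\<P>(\<omega> in M. \<forall>t\<in>J. X t \<omega> \<le> a t) \<le> \<P>(\<omega> in M. \<forall>s\<in>{t}. X s \<omega> \<le> 0)"
      using t sets_Collect_le_finite[OF X, of "{t}" "\<lambda>_. 0"] by (intro M.finite_measure_mono) force+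
    moreover have "\<P>(\<omega> in N. \<forall>t\<in>J. Y t \<omega> \<le> a t) \<le> \<P>(\<omega> in N. \<forall>s\<in>{t}. Y s \<omega> \<le> 0)"
      using t sets_Collect_le_finite[OF Y, of "{t}" "\<lambda>_. 0"] by (intro N.finite_measure_mono) force+
    ultimately show ?thesis
      using X0[OF t(1)] Y0[OF t(1)] by (simp add: measure_le_0_iff)
  qed
  then show "\<P>(f in fdd J M X. \<forall>t\<in>J. f t \<le> a t) = \<P>(f in fdd J N Y. \<forall>t\<in>J. f t \<le> a t)"
    using J by (simp add: prob_fdd_le[OF X] prob_fdd_le[OF Y])
qed

text \<open>The maximum stays below a level exactly when every copy does. Independence turns this
  into a product of \<open>n\<close> factors, equal because the copies share the finite-dimensional
  laws of \<open>X\<close>.\<close>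

lemma prob_copies_max_le:
  assumes "independent_copies T M X n N X'" "random_field T M X" "n \<ge> 1" "finite K" "K \<subseteq> T"
  shows "\<P>(\<omega> in N. \<forall>t\<in>K. (MAX i\<in>{..<n}. X' i t \<omega>) / real n \<le> a t)
    = \<P>(\<omega> in M. \<forall>t\<in>K. X t \<omega> \<le> real n * a t) ^ n"
proof -
  have X': "random_field T N (X' i)" and fdd: "fdd K N (X' i) = fdd K M X" if "i < n" for i
    using assms that by (auto simp: independent_copies_def same_fdds_def)
  have indep: "prob_space.indep_vars N (\<lambda>i. \<Pi>\<^sub>M t\<in>T. borel) (\<lambda>i \<omega>. \<lambda>t\<in>T. X' i t \<omega>) {..<n}"
    using assms by (simp add: independent_copies_def)
  interpret N: prob_space N using X'[of 0] assms by (auto simp: random_field_def)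
  \<comment> \<open>Independence is stated on the whole path space, so the event becomes a cylinder
    over \<open>T\<close> that constrains the coordinates in \<open>K\<close> only.\<close>
  define A where "A = {f\<in>space (\<Pi>\<^sub>M t\<in>T. borel). \<forall>t\<in>K. f t \<le> real n * a t}"
  have pre: "(\<lambda>\<omega>. \<lambda>t\<in>T. X' i t \<omega>) -` A \<inter> space N = {\<omega>\<in>space N. \<forall>t\<in>K. X' i t \<omega> \<le> real n * a t}" for i
    using assms by (auto simp: A_def space_PiM)
  have "{\<omega>\<in>space N. \<forall>t\<in>K. (MAX i\<in>{..<n}. X' i t \<omega>) / real n \<le> a t} =
      (\<Inter>i\<in>{..<n}. (\<lambda>\<omega>. \<lambda>t\<in>T. X' i t \<omega>) -` A \<inter> space N)"
    unfolding pre using assms(3) INT_E[of _ _ "{..<n}" 0]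
    by (fastforce simp: pos_divide_le_eq mult.commute Max_le_iff lessThan_empty_iff)
  also have "N.prob \<dots> = (\<Prod>i\<in>{..<n}. N.prob ((\<lambda>\<omega>. \<lambda>t\<in>T. X' i t \<omega>) -` A \<inter> space N))"
    using assms by (intro N.indep_varsD[OF indep])
      (auto simp: A_def lessThan_empty_iff intro!: sets_PiM_Collect_le_finite)
  also have "\<dots> = (\<Prod>i\<in>{..<n}. \<P>(\<omega> in M. \<forall>t\<in>K. X t \<omega> \<le> real n * a t))"
  proof (rule prod.cong)
    fix i assume i: "i \<in> {..<n}"
    then have "i < n" by simp
    then show "N.prob ((\<lambda>\<omega>. \<lambda>t\<in>T. X' i t \<omega>) -` A \<inter> space N) = \<P>(\<omega> in M. \<forall>t\<in>K. X t \<omega> \<le> real n * a t)"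
      unfolding pre using prob_fdd_le[OF X' \<open>K \<subseteq> T\<close> \<open>finite K\<close> order_refl, of i "\<lambda>t. real n * a t"]
        prob_fdd_le[OF assms(2) \<open>K \<subseteq> T\<close> \<open>finite K\<close> order_refl, of "\<lambda>t. real n * a t"] fdd[of i] by simp
  qed simp
  finally show ?thesis by simp
qed

text \<open>\<open>max_stable\<close> speaks about given copies and yields information only once
  some exist. The product space supplies them, and it has the type over which
  \<open>max_stable\<close> quantifies.\<close>

lemma independent_copies_PiM:
  assumes X: "random_field T M X" and n: "n \<ge> 1"
  shows "independent_copies T M X n (\<Pi>\<^sub>M i\<in>{..<n}. M) (\<lambda>i t \<omega>. X t (\<omega> i))"
  unfolding independent_copies_def
proof (intro conjI allI impI)
  interpret M: prob_space M using X by (simp add: random_field_def)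
  interpret product_prob_space "\<lambda>_. M" "{..<n}" ..
  show "random_field T (\<Pi>\<^sub>M i\<in>{..<n}. M) (\<lambda>t \<omega>. X t (\<omega> i))" if "i < n" for i
    using X that by (auto simp: random_field_def prob_space_axioms)
  show "same_fdds T (\<Pi>\<^sub>M i\<in>{..<n}. M) (\<lambda>t \<omega>. X t (\<omega> i)) M X" if "i < n" for i
    unfolding same_fdds_def
  proof (intro allI impI)
    fix J assume J: "finite J \<and> J \<subseteq> T"
    have "fdd J M X = distr (distr (\<Pi>\<^sub>M i\<in>{..<n}. M) M (\<lambda>\<omega>. \<omega> i)) (\<Pi>\<^sub>M t\<in>J. borel) (\<lambda>\<omega>. \<lambda>t\<in>J. X t \<omega>)"
      using that by (simp add: fdd_def PiM_component)
    also have "\<dots> = fdd J (\<Pi>\<^sub>M i\<in>{..<n}. M) (\<lambda>t \<omega>. X t (\<omega> i))"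
      unfolding fdd_def using that J measurable_restrict_field[OF X]
      by (subst distr_distr) (auto simp: comp_def)
    finally show "fdd J (\<Pi>\<^sub>M i\<in>{..<n}. M) (\<lambda>t \<omega>. X t (\<omega> i)) = fdd J M X" ..
  qed
  have "indep_vars (\<lambda>_. M) (\<lambda>i \<omega>. \<omega> i) {..<n}"
  proof (subst indep_vars_iff_distr_eq_PiM')
    have "distr (\<Pi>\<^sub>M i\<in>{..<n}. M) (\<Pi>\<^sub>M i\<in>{..<n}. M) (\<lambda>x. \<lambda>i\<in>{..<n}. x i) = distr (\<Pi>\<^sub>M i\<in>{..<n}. M) (\<Pi>\<^sub>M i\<in>{..<n}. M) (\<lambda>x. x)"
      by (intro distr_cong) (auto simp: space_PiM)
    moreover have "(\<Pi>\<^sub>M i\<in>{..<n}. distr (\<Pi>\<^sub>M i\<in>{..<n}. M) M (\<lambda>\<omega>. \<omega> i)) = (\<Pi>\<^sub>M i\<in>{..<n}. M)"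
      by (intro PiM_cong) (auto simp: PiM_component)
    ultimately show "distr (\<Pi>\<^sub>M i\<in>{..<n}. M) (\<Pi>\<^sub>M i\<in>{..<n}. M) (\<lambda>x. \<lambda>i\<in>{..<n}. x i) =
      (\<Pi>\<^sub>M i\<in>{..<n}. distr (\<Pi>\<^sub>M i\<in>{..<n}. M) M (\<lambda>\<omega>. \<omega> i))" by simp
  qed (use n in \<open>auto simp: lessThan_empty_iff\<close>)
  then show "indep_vars (\<lambda>i. \<Pi>\<^sub>M t\<in>T. borel) (\<lambda>i \<omega>. \<lambda>t\<in>T. X t (\<omega> i)) {..<n}"
    by (rule indep_vars_compose2) (rule measurable_restrict_field[OF X order_refl])
qed

section \<open>Tail dependence of max-stable fields\<close>

lemma random_field_copies_max:
  assumes "independent_copies T M X n N X'" "n \<ge> 1"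
  shows "random_field T N (\<lambda>t \<omega>. (MAX i\<in>{..<n}. X' i t \<omega>) / real n)"
proof -
  have X': "random_field T N (X' i)" if "i < n" for i
    using assms that by (auto simp: independent_copies_def)
  have "(\<lambda>\<omega>. MAX i\<in>{..<n}. X' i t \<omega>) \<in> borel_measurable N" if "t \<in> T" for t
    using X' that by (intro borel_measurable_Max) (auto simp: random_field_def)
  then show ?thesis
    using X'[of 0] assms(2) by (auto simp: random_field_def)
qed

context
  fixes T :: "'t set" and M :: "'w measure" and X
  assumes field: "random_field T M X" and Frechet: "standard_Frechet T M X"
begin

interpretation prob_space M
  using field by (simp add: random_field_def)

lemma Frechet_measurable: "t \<in> T \<Longrightarrow> X t \<in> borel_measurable M"
  using field by (simp add: random_field_def)

lemma Frechet_prob_le: "t \<in> T \<Longrightarrow> \<P>(\<omega> in M. X t \<omega> \<le> x) = (if x \<le> 0 then 0 else exp (- 1 / x))"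
proof (cases "0 \<le> x")
  case False
  assume t: "t \<in> T"
  note [measurable] = Frechet_measurable[OF t]
  have "\<P>(\<omega> in M. X t \<omega> \<le> x) \<le> \<P>(\<omega> in M. X t \<omega> \<le> 0)"
    using False by (intro finite_measure_mono) auto
  with False t Frechet show ?thesis
    by (auto simp: standard_Frechet_def measure_le_0_iff)
qed (use Frechet in \<open>auto simp: standard_Frechet_def\<close>)

text \<open>The distribution function is continuous at \<open>x > 0\<close>, so there is no atom.
  This lets the events with \<ge> in the tail dependence be traded for complements of events with
  \<le>.\<close>

lemma Frechet_AE_neq:
  assumes t: "t \<in> T" and x: "x > 0"
  shows "AE \<omega> in M. X t \<omega> \<noteq> x"
proof -
  note [measurable] = Frechet_measurable[OF t]
  interpret D: real_distribution "distr M borel (X t)" by simp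
  have cdf: "cdf (distr M borel (X t)) y = \<P>(\<omega> in M. X t \<omega> \<le> y)" for y
    by (auto simp: cdf_def measure_distr intro!: arg_cong[of _ _ prob])
  have "isCont (\<lambda>y. exp (- 1 / y)) x"
    using x by (intro continuous_intros) auto
  moreover have "\<forall>\<^sub>F y in nhds x. exp (- 1 / y) = cdf (distr M borel (X t)) y"
    using eventually_nhds_in_open[of "{0<..}" x] x
    by (auto elim!: eventually_mono simp: cdf Frechet_prob_le[OF t])
  ultimately have "isCont (cdf (distr M borel (X t))) x"
    using isCont_cong by fast
  then have "measure (distr M borel (X t)) {x} = 0"
    by (simp add: D.isCont_cdf)
  then have "\<P>(\<omega> in M. X t \<omega> = x) = 0"
    by (simp add: measure_distr vimage_def Int_def conj_commute)
  then show ?thesis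
    by (subst (asm) prob_eq_0) auto
qed

lemma Frechet_prob_ge:
  assumes t: "t \<in> T" and x: "x > 0"
  shows "\<P>(\<omega> in M. X t \<omega> \<ge> x) = 1 - exp (- 1 / x)"
proof -
  note [measurable] = Frechet_measurable[OF t]
  have "AE \<omega> in M. X t \<omega> \<noteq> x"
    by (rule Frechet_AE_neq[OF t x])
  then have "\<P>(\<omega> in M. X t \<omega> \<ge> x) = \<P>(\<omega> in M. \<not> X t \<omega> \<le> x)"
    by (intro prob_eq_AE) auto
  also have "\<dots> = 1 - exp (- 1 / x)"
    using x by (subst prob_neg) (auto simp: Frechet_prob_le[OF t])
  finally show ?thesis .
qed

text \<open>Inclusion-exclusion for the complementary union of \<open>X s \<omega> \<le> x\<close>
  and \<open>X t \<omega> \<le> x\<close>, the boundary being a null set.\<close>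

lemma Frechet_prob_joint_ge:
  assumes s: "s \<in> T" and t: "t \<in> T" and x: "x > 0"
  shows "\<P>(\<omega> in M. X s \<omega> \<ge> x \<and> X t \<omega> \<ge> x) = 1 - 2 * exp (- 1 / x) + \<P>(\<omega> in M. X s \<omega> \<le> x \<and> X t \<omega> \<le> x)"
proof -
  note [measurable] = Frechet_measurable[OF t] Frechet_measurable[OF s]
  have "AE \<omega> in M. X t \<omega> \<noteq> x" "AE \<omega> in M. X s \<omega> \<noteq> x"
    by (rule Frechet_AE_neq[OF t x] Frechet_AE_neq[OF s x])+
  then have "\<P>(\<omega> in M. X s \<omega> \<ge> x \<and> X t \<omega> \<ge> x) = \<P>(\<omega> in M. \<not> (X s \<omega> \<le> x \<or> X t \<omega> \<le> x))"
    by (intro prob_eq_AE) auto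
  also have "\<dots> = 1 - \<P>(\<omega> in M. X s \<omega> \<le> x \<or> X t \<omega> \<le> x)"
    by (subst prob_neg) auto
  also have "{\<omega>\<in>space M. X s \<omega> \<le> x \<or> X t \<omega> \<le> x} = {\<omega>\<in>space M. X s \<omega> \<le> x} \<union> {\<omega>\<in>space M. X t \<omega> \<le> x}"
    by auto
  also have "prob \<dots> = 2 * exp (- 1 / x) - prob ({\<omega>\<in>space M. X s \<omega> \<le> x} \<inter> {\<omega>\<in>space M. X t \<omega> \<le> x})"
    using x by (subst measure_Un3) (auto simp: fmeasurable_eq_sets Frechet_prob_le[OF t] Frechet_prob_le[OF s])
  also have "{\<omega>\<in>space M. X s \<omega> \<le> x} \<inter> {\<omega>\<in>space M. X t \<omega> \<le> x} = {\<omega>\<in>space M. X s \<omega> \<le> x \<and> X t \<omega> \<le> x}"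
    by auto
  finally show ?thesis by simp
qed

text \<open>The conditional probability is a quotient whose denominator behaves like
  \<open>1 / x\<close> and whose numerator behaves like \<open>(2 - \<theta>) / x\<close>, up to
  lower order.\<close>

lemma tendsto_tail_Frechet:
  assumes s: "s \<in> T" and t: "t \<in> T"
    and joint: "\<And>x. x > 0 \<Longrightarrow> \<P>(\<omega> in M. X s \<omega> \<le> x \<and> X t \<omega> \<le> x) = exp (- \<theta> / x)"
  shows "((\<lambda>x. \<P>(\<omega> in M. X s \<omega> \<ge> x \<bar> X t \<omega> \<ge> x)) \<longlongrightarrow> 2 - \<theta>) at_top"
proof -
  have "((\<lambda>x::real. (1 - 2 * exp (- 1 / x) + exp (- \<theta> / x)) / (1 - exp (- 1 / x))) \<longlongrightarrow> 2 - \<theta>) at_top"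
    by real_asymp
  moreover have "\<forall>\<^sub>F x in at_top. (1 - 2 * exp (- 1 / x) + exp (- \<theta> / x)) / (1 - exp (- 1 / x)) =
      \<P>(\<omega> in M. X s \<omega> \<ge> x \<bar> X t \<omega> \<ge> x)"
    using eventually_gt_at_top[of 0]
    by eventually_elim (simp add: cond_prob_def Frechet_prob_joint_ge[OF s t] Frechet_prob_ge[OF t] joint)
  ultimately show ?thesis
    using Lim_transform_eventually by fast
qed

text \<open>Max-stability gives \<open>G x = G (n * x) ^ n\<close> for the diagonal distribution
  function \<open>G\<close>. Its negative logarithm \<open>L\<close> then satisfies
  \<open>L x = n * L (n * x)\<close>, and monotonicity leaves only \<open>L x = L 1 / x\<close>.
  Thus \<theta> is \<open>L 1\<close>.\<close>

lemma max_stable_joint: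
  assumes ms: "max_stable T M X" and s: "s \<in> T" and t: "t \<in> T"
  obtains \<theta> where "\<And>x. x > 0 \<Longrightarrow> \<P>(\<omega> in M. X s \<omega> \<le> x \<and> X t \<omega> \<le> x) = exp (- \<theta> / x)"
proof -
  note [measurable] = Frechet_measurable[OF t] Frechet_measurable[OF s]
  define G where "G x = \<P>(\<omega> in M. \<forall>u\<in>{s, t}. X u \<omega> \<le> x)" for x
  have G_stable: "G x = G (real n * x) ^ n" if n: "n \<ge> 1" for n x
  proof -
    let ?N = "\<Pi>\<^sub>M i\<in>{..<n}. M" and ?X = "\<lambda>i t \<omega>. X t (\<omega> i)"
    have K: "{s, t} \<subseteq> T" "finite {s, t}" using s t by auto
    have copies: "independent_copies T M X n ?N ?X"
      by (rule independent_copies_PiM[OF field n])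
    then have "fdd {s, t} ?N (\<lambda>t \<omega>. (MAX i\<in>{..<n}. ?X i t \<omega>) / real n) = fdd {s, t} M X"
      using ms n K unfolding max_stable_def same_fdds_def by blast
    then show ?thesis
      using prob_fdd_le[OF field K(1) K(2) order_refl, of "\<lambda>_. x"]
        prob_fdd_le[OF random_field_copies_max[OF copies n] K(1) K(2) order_refl, of "\<lambda>_. x"]
        prob_copies_max_le[OF copies field n K(2) K(1), of "\<lambda>_. x"]
      unfolding G_def by simp
  qed
  have G_mono: "G x \<le> G y" if "x \<le> y" for x y
    unfolding G_def using that by (intro finite_measure_mono) auto
  have G_pos: "G x > 0" if "x > 0" for x
  proof -
    \<comment> \<open>Positivity is needed before taking logarithms. At \<open>y = n * x\<close>
      with \<open>1 / y < ln 2\<close> both marginal events have probability above 1/2, hence they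
      meet with positive probability; \<open>G_stable\<close> carries this back to
      \<open>x\<close>.\<close>
    obtain n :: nat where n: "real n > max 1 (1 / (x * ln 2))" using reals_Archimedean2 by blast
    define y where "y = real n * x"
    have y: "y > 0" "1 / y < ln 2" using n that by (auto simp: y_def field_simps)
    have "exp (- 1 / y) > exp (- ln 2)" using y by simp
    then have "exp (- 1 / y) > 1 / 2" by (simp add: exp_minus)
    moreover have "0 \<le> 1 - 2 * exp (- 1 / y) + G y"
      using Frechet_prob_joint_ge[OF s t y(1)] measure_nonneg[of M "{\<omega>\<in>space M. X s \<omega> \<ge> y \<and> X t \<omega> \<ge> y}"]
      by (simp add: G_def)
    ultimately have "G y > 0" by linarith
    then show ?thesis
      using G_stable[of n x] n by (simp add: y_def)
  qed
  define L where "L x = - ln (G x)" for x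
  have L: "L x = real n * L (real n * x)" if "n \<ge> 1" "x > 0" for n x
    using that G_stable[of n x] G_pos[of "real n * x"] by (simp add: L_def ln_realpow)
  have L_anti: "L y \<le> L x" if "0 < x" "x \<le> y" for x y
    using that G_mono[of x y] G_pos[of x] G_pos[of y] by (simp add: L_def)
  \<comment> \<open>Combine \<open>L (m / n) = n * L m\<close> with
    \<open>L 1 = m * L m\<close>.\<close>
  have L_rat: "L (real m / real n) = L 1 / (real m / real n)" if "m \<ge> 1" "n \<ge> 1" for m n
    using L[of n "real m / real n"] L[of m 1] that by (simp add: field_simps)
  have L_nonneg: "L 1 \<ge> 0"
    using G_pos[of 1] by (auto simp: L_def G_def)
  \<comment> \<open>\<open>x * L x\<close> is constant on the positive rationals, and \<open>L\<close> is monotone.\<close>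
  have L_eq: "L x = L 1 / x" if x: "x > 0" for x
  proof (rule antisym)
    \<comment> \<open>Rationals below \<open>x\<close> bound \<open>L x\<close> from above,
      rationals above \<open>x\<close> bound it from below. If \<open>L x\<close> differed from
      \<open>L 1 / x\<close>, a rational between \<open>x\<close> and \<open>L 1 / L x\<close> would
      violate one of the bounds.\<close>
    have lower: "L x * q \<le> L 1" if q: "q \<in> \<rat>" "0 < q" "q < x" for q
    proof -
      obtain m n where mn: "q = real m / real n" "n \<noteq> 0"
        using Rats_abs_nat_div_natE[OF q(1)] q by (metis abs_of_pos)
      with q have "m \<ge> 1" "n \<ge> 1" by (auto simp: Suc_le_eq intro: gr0I)
      then have "L q = L 1 / q" using L_rat mn by simp
      with L_anti[of q x] q show ?thesis by (simp add: field_simps)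
    qed
    have upper: "L 1 \<le> L x * q" if q: "q \<in> \<rat>" "x < q" for q
    proof -
      obtain m n where mn: "q = real m / real n" "n \<noteq> 0"
        using Rats_abs_nat_div_natE[OF q(1)] q x by (metis abs_of_pos less_trans)
      with q x have "m \<ge> 1" "n \<ge> 1" by (auto simp: Suc_le_eq intro: gr0I)
      then have "L q = L 1 / q" using L_rat mn by simp
      with L_anti[of x q] q x show ?thesis by (simp add: field_simps)
    qed
    show "L x \<le> L 1 / x"
    proof (rule ccontr)
      assume "\<not> L x \<le> L 1 / x"
      then have *: "L 1 < L x * x" using x by (simp add: field_simps)
      then have "L x > 0" using L_nonneg x by (smt (verit) zero_less_mult_pos2)
      with * have "L 1 / L x < x" by (simp add: field_simps)
      then have "max 0 (L 1 / L x) < x" using x by simp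
      then obtain q where "q \<in> \<rat>" "max 0 (L 1 / L x) < q" "q < x" using Rats_dense_in_real by blast
      with lower[of q] \<open>L x > 0\<close> show False by (simp add: field_simps)
    qed
    show "L 1 / x \<le> L x"
    proof (rule ccontr)
      assume "\<not> L 1 / x \<le> L x"
      then have *: "L x * x < L 1" using x by (simp add: field_simps)
      have "L x \<ge> 0"
        using G_pos[OF x] by (auto simp: L_def G_def)
      show False
      \<comment> \<open>For \<open>L x = 0\<close> the threshold \<open>L 1 / L x\<close> is
        meaningless; there any rational above \<open>x\<close> gives the contradiction
        \<open>L 1 \<le> 0\<close>.\<close>
      proof (cases "L x = 0")
        case True
        obtain q where "q \<in> \<rat>" "x < q" using Rats_dense_in_real[of x "x + 1"] by auto
        with upper[of q] True * show False by simp
      next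
        case False
        with \<open>L x \<ge> 0\<close> have "L x > 0" by simp
        with * have "x < L 1 / L x" by (simp add: field_simps)
        then obtain q where "q \<in> \<rat>" "q < L 1 / L x" "x < q" using Rats_dense_in_real by blast
        with upper[of q] \<open>L x > 0\<close> show False by (simp add: field_simps)
      qed
    qed
  qed
  show thesis
  proof (rule that[of "L 1"])
    fix x :: real assume x: "x > 0"
    have "G x = exp (- L x)" using G_pos[OF x] by (simp add: L_def)
    then show "\<P>(\<omega> in M. X s \<omega> \<le> x \<and> X t \<omega> \<le> x) = exp (- L 1 / x)"
      using L_eq[OF x] by (simp add: G_def)
  qed
qed

lemma Frechet_identical_marginals: "identical_marginals T M X"
  unfolding identical_marginals_def
proof (intro ballI)
  fix s t assume s: "s \<in> T" and t: "t \<in> T"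
  note [measurable] = Frechet_measurable[OF t] Frechet_measurable[OF s]
  have "cdf (distr M borel (X u)) = (\<lambda>x. \<P>(\<omega> in M. X u \<omega> \<le> x))" if [measurable]: "X u \<in> borel_measurable M" for u
    by (auto simp: cdf_def measure_distr fun_eq_iff intro!: arg_cong[of _ _ prob])
  then show "distr M borel (X s) = distr M borel (X t)"
    by (intro cdf_unique real_distribution_distr) (auto simp: Frechet_prob_le[OF t] Frechet_prob_le[OF s])
qed

lemma Frechet_prob_gt_pos:
  assumes t: "t \<in> T"
  shows "\<P>(\<omega> in M. X t \<omega> > x) > 0"
proof -
  note [measurable] = Frechet_measurable[OF t]
  have "\<P>(\<omega> in M. X t \<omega> > x) = \<P>(\<omega> in M. \<not> X t \<omega> \<le> x)" by (simp add: not_le)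
  also have "\<dots> = 1 - \<P>(\<omega> in M. X t \<omega> \<le> x)" by (subst prob_neg) auto
  also have "\<dots> > 0" by (auto simp: Frechet_prob_le[OF t])
  finally show ?thesis .
qed

end

text \<open>The point is the existence of the limits, demanded by \<open>Xi_lim\<close> but not by
  \<open>Xi_max\<close>; the exponential form of the bivariate laws provides it.\<close>

lemma Xi_max_subset_Xi_lim:
  fixes T :: "'t set"
  shows "Xi_max T \<subseteq> Xi_lim T"
proof
  fix f assume "f \<in> Xi_max T"
  then obtain M :: "('t \<Rightarrow> real) measure" and X
    where f: "f = restrict (tail_dependence M X) (T \<times> T)"
    and X: "random_field T M X" "standard_Frechet T M X" and ms: "max_stable T M X"
    by (auto simp: Xi_max_def)
  have "tail_dependence_exists T M X"
    unfolding tail_dependence_exists_def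
  proof (intro ballI)
    fix s t assume st: "s \<in> T" "t \<in> T"
    obtain \<theta> where "\<And>x. x > 0 \<Longrightarrow> \<P>(\<omega> in M. X s \<omega> \<le> x \<and> X t \<omega> \<le> x) = exp (- \<theta> / x)"
      using max_stable_joint[OF X ms st] by blast
    from tendsto_tail_Frechet[OF X st this]
    show "\<exists>l. ((\<lambda>x. \<P>(\<omega> in M. X s \<omega> \<ge> x \<bar> X t \<omega> \<ge> x)) \<longlongrightarrow> l) at_top" by blast
  qed
  with f X Frechet_identical_marginals[OF X] Frechet_prob_gt_pos[OF X] show "f \<in> Xi_lim T"
    unfolding Xi_lim_def by blast
qed

section \<open>Approximation of tail dependence by exceedance fields\<close>

lemma Xi_bin_subset_topspace:
  "Xi_bin T \<subseteq> topspace (product_topology (\<lambda>_. euclideanreal) (T \<times> T))"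
proof
  fix f assume "f \<in> Xi_bin T"
  then obtain g where "f = restrict g (T \<times> T)" unfolding Xi_bin_def by blast
  then show "f \<in> topspace (product_topology (\<lambda>_. euclideanreal) (T \<times> T))" by simp
qed

lemma Xi_lim_subset_closure_Xi_bin:
  fixes T :: "'t set"
  shows "Xi_lim T \<subseteq> pointwise_closure T (Xi_bin T)"
proof
  fix f assume "f \<in> Xi_lim T"
  then obtain M :: "('t \<Rightarrow> real) measure" and Z
    where f: "f = restrict (tail_dependence M Z) (T \<times> T)"
    and Z: "random_field T M Z" and im: "identical_marginals T M Z"
    and pos: "\<And>t x. t \<in> T \<Longrightarrow> \<P>(\<omega> in M. Z t \<omega> > x) > 0"
    and ex: "tail_dependence_exists T M Z"
    by (auto simp: Xi_lim_def)
  interpret prob_space M using Z by (simp add: random_field_def)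
  have meas: "Z t \<in> borel_measurable M" if "t \<in> T" for t
    using Z that by (simp add: random_field_def)
  \<comment> \<open>The function of the binary field of exceedances of level \<open>x\<close>. The
    infinite upper endpoint keeps its mean nonzero at every level, and letting \<open>x\<close> tend
    to infinity gives \<open>f\<close> pointwise.\<close>
  define f' where "f' x = (\<lambda>(s, t)\<in>T \<times> T. \<P>(\<omega> in M. Z s \<omega> \<ge> x \<bar> Z t \<omega> \<ge> x))" for x
  have bin: "f' x \<in> Xi_bin T" for x
  proof -
    define Y where "Y t \<omega> = (indicator {x..} (Z t \<omega>) :: real)" for t \<omega>
    have "distr M borel (Y s) = distr M borel (Y t)" if "s \<in> T" "t \<in> T" for s t
    proof -
      \<comment> \<open>The law of \<open>Y u\<close> is the image of the law of \<open>Z u\<close>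
        under one map not depending on \<open>u\<close>, so equality of the marginals is
        inherited.\<close>
      have push: "distr M borel (Y u) = distr (distr M borel (Z u)) borel (indicator {x..})" if "u \<in> T" for u
        using meas[OF that] by (subst distr_distr) (auto simp: Y_def[abs_def] comp_def)
      have "distr M borel (Z s) = distr M borel (Z t)"
        using im that unfolding identical_marginals_def by blast
      then show ?thesis by (simp only: push[OF that(1)] push[OF that(2)])
    qed
    moreover have "expectation (Y t) \<noteq> 0" if t: "t \<in> T" for t
    proof -
      note [measurable] = meas[OF t]
      have "expectation (Y t) = expectation (indicator {\<omega>\<in>space M. Z t \<omega> \<ge> x})"
        by (intro Bochner_Integration.integral_cong) (auto simp: Y_def indicator_def)
      also have "\<dots> = \<P>(\<omega> in M. Z t \<omega> \<ge> x)" by simp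
      also have "\<dots> \<ge> \<P>(\<omega> in M. Z t \<omega> > x)" by (intro finite_measure_mono) auto
      finally show ?thesis using pos[OF t, of x] by linarith
    qed
    moreover have "random_field T M Y"
      unfolding random_field_def
    proof (intro conjI ballI)
      fix t assume "t \<in> T"
      note [measurable] = meas[OF this]
      show "Y t \<in> borel_measurable M" unfolding Y_def by measurable
    qed (fact prob_space_axioms)
    moreover have "f' x = (\<lambda>(s, t)\<in>T \<times> T. \<P>(\<omega> in M. Y s \<omega> = 1 \<bar> Y t \<omega> = 1))"
      by (simp add: f'_def Y_def indicator_eq_1_iff)
    moreover have "\<forall>t\<in>T. \<forall>\<omega>\<in>space M. Y t \<omega> \<in> {0, 1}"
      by (auto simp: Y_def indicator_def)
    ultimately show ?thesis
      unfolding Xi_bin_def identical_marginals_def by blast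
  qed
  have "limitin (product_topology (\<lambda>_. euclideanreal) (T \<times> T)) f' f at_top"
    unfolding limitin_componentwise
  proof (intro conjI ballI)
    show "f \<in> extensional (T \<times> T)" by (simp add: f)
    show "\<forall>\<^sub>F x in at_top. f' x \<in> topspace (product_topology (\<lambda>_. euclideanreal) (T \<times> T))"
      by (intro always_eventually allI) (auto simp: f'_def)
    fix p assume "p \<in> T \<times> T"
    then obtain s t where p: "p = (s, t)" "s \<in> T" "t \<in> T" by auto
    then obtain l where l: "((\<lambda>x. \<P>(\<omega> in M. Z s \<omega> \<ge> x \<bar> Z t \<omega> \<ge> x)) \<longlongrightarrow> l) at_top"
      using ex by (auto simp: tail_dependence_exists_def)
    with l show "limitin euclideanreal (\<lambda>x. f' x p) (f p) at_top"
      using tendsto_Lim[OF _ l] p by (simp add: f f'_def tail_dependence_def)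
  qed
  then show "f \<in> pointwise_closure T (Xi_bin T)"
    by (rule limitin_closedin) (use bin closure_of_subset[OF Xi_bin_subset_topspace] in \<open>auto intro!: always_eventually\<close>)
qed

section \<open>Max-stable fields with prescribed weights\<close>

definition Frechet_df :: "real \<Rightarrow> real" where
  "Frechet_df x = (if x \<le> 0 then 0 else exp (- 1 / x))"

definition Frechet_measure :: "real measure" where
  "Frechet_measure = interval_measure Frechet_df"

lemma Frechet_df_mono: "x \<le> y \<Longrightarrow> Frechet_df x \<le> Frechet_df y"
  by (auto simp: Frechet_df_def frac_le)

lemma Frechet_df_right_cont: "continuous (at_right a) Frechet_df"
proof -
  consider "a < 0" | "a = 0" | "a > 0" by linarith
  then show ?thesis
  proof cases
    case 1
    have "\<forall>\<^sub>F x in at_right a. 0 = Frechet_df x"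
      using eventually_at_right_real[OF 1] by eventually_elim (auto simp: Frechet_df_def)
    then have "(Frechet_df \<longlongrightarrow> 0) (at_right a)"
      by (rule Lim_transform_eventually[rotated]) auto
    with 1 show ?thesis by (simp add: continuous_within Frechet_df_def)
  next
    case 2
    have "((\<lambda>x::real. exp (- 1 / x)) \<longlongrightarrow> 0) (at_right 0)" by real_asymp
    moreover have "\<forall>\<^sub>F x in at_right 0. exp (- 1 / x) = Frechet_df x"
      using eventually_at_right_less[of "0::real"] by eventually_elim (auto simp: Frechet_df_def)
    ultimately have "(Frechet_df \<longlongrightarrow> 0) (at_right 0)"
      using Lim_transform_eventually by fast
    with 2 show ?thesis by (simp add: continuous_within Frechet_df_def)
  next
    case 3
    have "((\<lambda>x. exp (- 1 / x)) \<longlongrightarrow> exp (- 1 / a)) (at_right a)"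
      using 3 by (intro tendsto_intros) auto
    moreover have "\<forall>\<^sub>F x in at_right a. exp (- 1 / x) = Frechet_df x"
      using eventually_at_right_less[of a] 3 by (auto elim!: eventually_mono simp: Frechet_df_def)
    ultimately have "(Frechet_df \<longlongrightarrow> exp (- 1 / a)) (at_right a)"
      using Lim_transform_eventually by fast
    with 3 show ?thesis by (simp add: continuous_within Frechet_df_def)
  qed
qed

lemma Frechet_df_at_bot: "(Frechet_df \<longlongrightarrow> 0) at_bot"
proof -
  have "\<forall>\<^sub>F x in at_bot. 0 = Frechet_df x"
    using eventually_le_at_bot[of 0] by eventually_elim (auto simp: Frechet_df_def)
  then show ?thesis by (rule Lim_transform_eventually[rotated]) auto
qed

lemma Frechet_df_at_top: "(Frechet_df \<longlongrightarrow> 1) at_top"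
proof -
  have "((\<lambda>x::real. exp (- 1 / x)) \<longlongrightarrow> 1) at_top" by real_asymp
  moreover have "\<forall>\<^sub>F x in at_top. exp (- 1 / x) = Frechet_df x"
    using eventually_gt_at_top[of 0] by eventually_elim (auto simp: Frechet_df_def)
  ultimately show ?thesis using Lim_transform_eventually by fast
qed

interpretation Frechet: real_distribution Frechet_measure
  unfolding Frechet_measure_def
  by (intro real_distribution_interval_measure Frechet_df_mono Frechet_df_right_cont
      Frechet_df_at_bot Frechet_df_at_top)

lemma measure_Frechet_atMost: "measure Frechet_measure {..x} = Frechet_df x"
  unfolding Frechet_measure_def
  by (intro measure_interval_measure_Iic Frechet_df_mono Frechet_df_right_cont Frechet_df_at_bot)

text \<open>For positive \<open>a\<close> each \<open>B\<close> contributes its weight times the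
  maximum of \<open>1 / a t\<close> over \<open>t \<in> B\<close>: the exponent function of the
  Tawn-Molchanov model.\<close>

definition stable_exponent :: "('t set \<times> 't set \<Rightarrow> real) \<Rightarrow> 't set \<Rightarrow> ('t \<Rightarrow> real) \<Rightarrow> real" where
  "stable_exponent m K a = (\<Sum>B\<in>Pow K - {{}}. m (K, B) / Min (a ` B))"

text \<open>Entries \<open>m (J, B)\<close> outside the range of the second condition are irrelevant; they are only kept
  in \<open>[0, 1]\<close> for compactness.\<close>

definition consistent_weights :: "'t set \<Rightarrow> ('t set \<times> 't set \<Rightarrow> real) set" where
  "consistent_weights T = {m. (\<forall>p. m p \<in> {0..1}) \<and>
    (\<forall>H J B. finite H \<and> J \<subseteq> H \<and> H \<subseteq> T \<and> B \<subseteq> J \<and> B \<noteq> {} \<longrightarrow>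
      (\<Sum>A\<in>{A\<in>Pow H. A \<inter> J = B}. m (H, A)) = m (J, B)) \<and>
    (\<forall>t\<in>T. m ({t}, {t}) = 1)}"

text \<open>Positive corners keep the minima in the exponent positive. For consistent weights they
  determine the finite-dimensional laws, since the marginals are then Frechet and put no mass on the
  nonpositive half-line.\<close>

definition has_exponent ::
  "'t set \<Rightarrow> ('t set \<times> 't set \<Rightarrow> real) \<Rightarrow> 'w measure \<Rightarrow> ('t \<Rightarrow> 'w \<Rightarrow> real) \<Rightarrow> bool" where
  "has_exponent T m M X \<longleftrightarrow> random_field T M X \<and>
    (\<forall>K a. finite K \<and> K \<subseteq> T \<and> (\<forall>t\<in>K. 0 < a t) \<longrightarrow>
      \<P>(\<omega> in M. \<forall>t\<in>K. X t \<omega> \<le> a t) = exp (- stable_exponent m K a))"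

text \<open>A max-linear model: under the product law the \<open>\<omega> A\<close> are independent
  Frechet shocks, and the shock of \<open>A\<close> hits exactly the sites in \<open>A\<close>. For
  \<open>t \<in> H\<close> the maximum runs over a nonempty family, as it contains
  \<open>{t}\<close>.\<close>

definition spectral_max ::
  "('t set \<times> 't set \<Rightarrow> real) \<Rightarrow> 't set \<Rightarrow> 't \<Rightarrow> ('t set \<Rightarrow> real) \<Rightarrow> real" where
  "spectral_max m H t \<omega> = (MAX A\<in>{A\<in>Pow H. t \<in> A}. m (H, A) * \<omega> A)"

lemma has_exponent_field: "has_exponent T m M X \<Longrightarrow> random_field T M X"
  by (simp add: has_exponent_def)

lemma has_exponentD:
  "has_exponent T m M X \<Longrightarrow> finite K \<Longrightarrow> K \<subseteq> T \<Longrightarrow> (\<And>t. t \<in> K \<Longrightarrow> 0 < a t) \<Longrightarrow>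
    \<P>(\<omega> in M. \<forall>t\<in>K. X t \<omega> \<le> a t) = exp (- stable_exponent m K a)"
  by (auto simp: has_exponent_def)

text \<open>Homogeneity of degree -1 is the analytic form of max-stability.\<close>

lemma stable_exponent_scale:
  assumes "finite K" "0 < c"
  shows "stable_exponent m K (\<lambda>t. c * a t) = stable_exponent m K a / c"
  unfolding stable_exponent_def sum_divide_distrib
proof (rule sum.cong)
  fix B assume B: "B \<in> Pow K - {{}}"
  have "Min ((\<lambda>t. c * a t) ` B) = c * Min (a ` B)"
    using B assms finite_subset[of B K]
    by (subst mono_Min_commute[where f="\<lambda>x. c * x"]) (auto simp: image_image mono_def)
  then show "m (K, B) / Min ((\<lambda>t. c * a t) ` B) = m (K, B) / Min (a ` B) / c" by simp
qed simp

lemma stable_exponent_singleton: "stable_exponent m {t} a = m ({t}, {t}) / a t"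
proof -
  have "Pow {t} - {{}} = {{t}}" by auto
  then show ?thesis by (simp add: stable_exponent_def)
qed

section \<open>Fields governed by consistent weights\<close>

context
  fixes T :: "'t set" and m :: "'t set \<times> 't set \<Rightarrow> real"
  assumes m: "m \<in> consistent_weights T"
begin

lemma weight_nonneg: "0 \<le> m p"
  using m unfolding consistent_weights_def atLeastAtMost_iff by blast

lemma weight_marginal:
  "finite H \<Longrightarrow> J \<subseteq> H \<Longrightarrow> H \<subseteq> T \<Longrightarrow> B \<subseteq> J \<Longrightarrow> B \<noteq> {} \<Longrightarrow>
    (\<Sum>A\<in>{A\<in>Pow H. A \<inter> J = B}. m (H, A)) = m (J, B)"
  using m unfolding consistent_weights_def by blast

lemma weight_singleton: "t \<in> T \<Longrightarrow> m ({t}, {t}) = 1"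
  using m by (auto simp: consistent_weights_def)

text \<open>The event splits into one condition on each shock \<open>\<omega> A\<close>, so its
  probability is a product. Collecting the sets \<open>A\<close> by their trace on \<open>K\<close>
  and applying consistency replaces the weights on \<open>H\<close> by those on
  \<open>K\<close>.\<close>

lemma spectral_max_has_exponent:
  assumes H: "finite H" "H \<subseteq> T"
  shows "has_exponent H m (\<Pi>\<^sub>M A\<in>Pow H. Frechet_measure) (spectral_max m H)"
  unfolding has_exponent_def
proof (intro conjI allI impI)
  interpret finite_product_prob_space "\<lambda>_. Frechet_measure" "Pow H"
    by unfold_locales (use H in auto)
  let ?Q = "\<Pi>\<^sub>M A\<in>Pow H. Frechet_measure"
  have "spectral_max m H t \<in> borel_measurable ?Q" if "t \<in> H" for t
    unfolding spectral_max_def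
  proof (rule borel_measurable_Max)
    fix A assume "A \<in> {A\<in>Pow H. t \<in> A}"
    then have [measurable]: "A \<in> Pow H" by simp
    show "(\<lambda>\<omega>. m (H, A) * \<omega> A) \<in> borel_measurable ?Q" by measurable
  qed (use H in auto)
  then show "random_field H ?Q (spectral_max m H)"
    by (auto simp: random_field_def prob_space_axioms)
  fix K a assume "finite K \<and> K \<subseteq> H \<and> (\<forall>t\<in>K. 0 < (a t :: real))"
  then have K: "finite K" "K \<subseteq> H" and a: "\<And>t. t \<in> K \<Longrightarrow> 0 < a t" by auto
  define S where "S A = {y. \<forall>t\<in>A \<inter> K. m (H, A) * y \<le> a t}" for A
  define w where "w A = (if A \<inter> K = {} then 0 else m (H, A) / Min (a ` (A \<inter> K)))" for A
  have S: "S A \<in> sets borel \<and> measure Frechet_measure (S A) = exp (- w A)" for A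
  \<comment> \<open>A shock that misses \<open>K\<close> or has zero weight is unconstrained;
    otherwise dividing by the weight makes \<open>S A\<close> a half-line.\<close>
  proof (cases "A \<inter> K = {} \<or> m (H, A) = 0")
    case True
    then have "S A = UNIV" using a by (force simp: S_def less_imp_le)
    then show ?thesis
      using True Frechet.prob_space by (auto simp: w_def)
  next
    case False
    then have pos: "m (H, A) > 0" using weight_nonneg[of "(H, A)"] by auto
    have fin: "finite (a ` (A \<inter> K))" "a ` (A \<inter> K) \<noteq> {}" using K False by auto
    have "0 < Min (a ` (A \<inter> K))" using fin a by (subst Min_gr_iff) auto
    moreover have "S A = {..Min (a ` (A \<inter> K)) / m (H, A)}"
      by (auto simp: S_def pos_le_divide_eq[OF pos] Min_ge_iff[OF fin] mult.commute)
    ultimately show ?thesis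
      using pos False by (simp add: measure_Frechet_atMost Frechet_df_def w_def not_le)
  qed
  have "{\<omega>\<in>space ?Q. \<forall>t\<in>K. spectral_max m H t \<omega> \<le> a t} = (\<Pi>\<^sub>E A\<in>Pow H. S A)"
  proof -
    have "spectral_max m H t \<omega> \<le> a t \<longleftrightarrow> (\<forall>A\<in>Pow H. t \<in> A \<longrightarrow> m (H, A) * \<omega> A \<le> a t)" if "t \<in> K" for t \<omega>
      unfolding spectral_max_def using H K that by (subst Max_le_iff) auto
    then show ?thesis
      by (auto simp: space_PiM S_def PiE_def Pi_iff Frechet_measure_def)
  qed
  then have "\<P>(\<omega> in ?Q. \<forall>t\<in>K. spectral_max m H t \<omega> \<le> a t) = measure ?Q (\<Pi>\<^sub>E A\<in>Pow H. S A)"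
    by simp
  also have "\<dots> = (\<Prod>A\<in>Pow H. measure Frechet_measure (S A))"
    using S by (intro finite_measure_PiM_emb) simp
  also have "\<dots> = exp (- (\<Sum>A\<in>Pow H. w A))"
    using S H by (simp add: exp_sum sum_negf[symmetric])
  \<comment> \<open>Group by the trace \<open>B = A \<inter> K\<close>; on each group the
    denominator in \<open>w\<close> is constant, and the empty trace contributes 0.\<close>
  also have "(\<Sum>A\<in>Pow H. w A) = (\<Sum>B\<in>Pow K. \<Sum>A\<in>{A\<in>Pow H. A \<inter> K = B}. w A)"
    using H K by (intro sum.group[symmetric]) auto
  also have "\<dots> = (\<Sum>B\<in>Pow K - {{}}. \<Sum>A\<in>{A\<in>Pow H. A \<inter> K = B}. w A)"
    using K by (intro sum.mono_neutral_right) (auto simp: w_def)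
  also have "\<dots> = stable_exponent m K a"
    unfolding stable_exponent_def
  proof (rule sum.cong)
    fix B assume B: "B \<in> Pow K - {{}}"
    have "(\<Sum>A\<in>{A\<in>Pow H. A \<inter> K = B}. w A) = (\<Sum>A\<in>{A\<in>Pow H. A \<inter> K = B}. m (H, A) / Min (a ` B))"
      using B by (intro sum.cong) (auto simp: w_def)
    also have "\<dots> = m (K, B) / Min (a ` B)"
      using B weight_marginal[OF H(1) K(2) H(2), of B] by (simp flip: sum_divide_distrib)
    finally show "(\<Sum>A\<in>{A\<in>Pow H. A \<inter> K = B}. w A) = m (K, B) / Min (a ` B)" .
  qed simp
  finally show "\<P>(\<omega> in ?Q. \<forall>t\<in>K. spectral_max m H t \<omega> \<le> a t) = exp (- stable_exponent m K a)" .
qed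

lemma has_exponent_subset: "has_exponent H m M X \<Longrightarrow> J \<subseteq> H \<Longrightarrow> has_exponent J m M X"
  unfolding has_exponent_def random_field_def by blast

lemma has_exponent_prob_le:
  assumes X: "has_exponent H m M X" and t: "t \<in> H" "t \<in> T"
  shows "\<P>(\<omega> in M. X t \<omega> \<le> x) = (if x \<le> 0 then 0 else exp (- 1 / x))"
proof -
  have field: "random_field H M X" using X by (rule has_exponent_field)
  then interpret prob_space M by (simp add: random_field_def)
  have [measurable]: "X t \<in> borel_measurable M" using field t by (simp add: random_field_def)
  have pos: "\<P>(\<omega> in M. X t \<omega> \<le> x) = exp (- 1 / x)" if "x > 0" for x
  proof -
    have "\<P>(\<omega> in M. \<forall>u\<in>{t}. X u \<omega> \<le> x) = exp (- stable_exponent m {t} (\<lambda>_. x))"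
      by (rule has_exponentD[OF X]) (use t that in auto)
    then show ?thesis using weight_singleton[OF t(2)] by (simp add: stable_exponent_singleton)
  qed
  \<comment> \<open>The exponent says nothing at 0, so the value there is squeezed below
    \<open>exp (- 1 / x)\<close> as \<open>x\<close> decreases to 0.\<close>
  have "\<P>(\<omega> in M. X t \<omega> \<le> 0) \<le> 0"
  proof (rule tendsto_lowerbound)
    show "((\<lambda>x::real. exp (- 1 / x)) \<longlongrightarrow> 0) (at_right 0)" by real_asymp
    show "\<forall>\<^sub>F x in at_right 0. \<P>(\<omega> in M. X t \<omega> \<le> 0) \<le> exp (- 1 / x)"
      using eventually_at_right_less[of "0::real"]
    proof eventually_elim
      case (elim x)
      have "\<P>(\<omega> in M. X t \<omega> \<le> 0) \<le> \<P>(\<omega> in M. X t \<omega> \<le> x)"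
        using elim by (intro finite_measure_mono) auto
      with pos[OF elim] show ?case by simp
    qed
  qed simp
  moreover have "\<P>(\<omega> in M. X t \<omega> \<le> x) \<le> \<P>(\<omega> in M. X t \<omega> \<le> 0)" if "x \<le> 0"
    using that by (intro finite_measure_mono) auto
  ultimately have "\<P>(\<omega> in M. X t \<omega> \<le> x) = 0" if "x \<le> 0"
    using that by (auto simp: measure_le_0_iff intro: order.trans)
  with pos show ?thesis by auto
qed

lemma has_exponent_Frechet:
  assumes "has_exponent T m M X"
  shows "standard_Frechet T M X"
  using has_exponent_prob_le[OF assms] by (auto simp: standard_Frechet_def)

text \<open>The exponent on \<open>J\<close> involves only \<open>m\<close> and \<open>J\<close>,
  neither the larger index sets nor the probability spaces. This yields both max-stability and the
  compatibility required by Kolmogorov extension.\<close>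

lemma has_exponent_fdd_eq:
  assumes X: "has_exponent H m M X" and Y: "has_exponent H' m N Y"
    and J: "finite J" "J \<subseteq> H" "J \<subseteq> H'" "J \<subseteq> T"
  shows "fdd J M X = fdd J N Y"
proof (rule fdd_eqI_positive)
  note XJ = has_exponent_subset[OF X J(2)] and YJ = has_exponent_subset[OF Y J(3)]
  show "random_field J M X" "random_field J N Y" using XJ YJ by (auto intro: has_exponent_field)
  show "\<P>(\<omega> in M. X t \<omega> \<le> 0) = 0" "\<P>(\<omega> in N. Y t \<omega> \<le> 0) = 0" if "t \<in> J" for t
    using has_exponent_prob_le[OF XJ that] has_exponent_prob_le[OF YJ that] that J by auto
  show "\<P>(\<omega> in M. \<forall>t\<in>J. X t \<omega> \<le> a t) = \<P>(\<omega> in N. \<forall>t\<in>J. Y t \<omega> \<le> a t)"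
    if "\<And>t. t \<in> J \<Longrightarrow> 0 < a t" for a
    using that by (simp add: has_exponentD[OF XJ J(1)] has_exponentD[OF YJ J(1)])
qed fact

text \<open>By homogeneity the n-th power undoes the scaling by \<open>n\<close>, so the rescaled
  maximum has the same exponent and hence the same laws.\<close>

lemma has_exponent_max_stable:
  fixes M :: "'w measure"
  assumes X: "has_exponent T m M X"
  shows "max_stable T M X"
  unfolding max_stable_def same_fdds_def
proof (intro allI impI)
  fix n :: nat and N :: "(nat \<Rightarrow> 'w) measure" and X' J
  assume n: "n \<ge> 1" and copies: "independent_copies T M X n N X'" and J: "finite J \<and> J \<subseteq> T"
  let ?Y = "\<lambda>t \<omega>. (MAX i\<in>{..<n}. X' i t \<omega>) / real n"
  have field: "random_field T M X" using X by (rule has_exponent_field)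
  have "has_exponent T m N ?Y"
    unfolding has_exponent_def
  proof (intro conjI allI impI)
    show "random_field T N ?Y" by (rule random_field_copies_max[OF copies n])
    fix K a assume K: "finite K \<and> K \<subseteq> T \<and> (\<forall>t\<in>K. 0 < (a t :: real))"
    then have "\<P>(\<omega> in N. \<forall>t\<in>K. ?Y t \<omega> \<le> a t) = \<P>(\<omega> in M. \<forall>t\<in>K. X t \<omega> \<le> real n * a t) ^ n"
      by (intro prob_copies_max_le[OF copies field n]) auto
    also have "\<P>(\<omega> in M. \<forall>t\<in>K. X t \<omega> \<le> real n * a t) = exp (- stable_exponent m K (\<lambda>t. real n * a t))"
      by (rule has_exponentD[OF X]) (use K n in auto)
    also have "\<dots> ^ n = exp (- stable_exponent m K a)"
      using K n by (simp add: stable_exponent_scale flip: exp_of_nat_mult)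
    finally show "\<P>(\<omega> in N. \<forall>t\<in>K. ?Y t \<omega> \<le> a t) = exp (- stable_exponent m K a)" .
  qed
  then show "fdd J N ?Y = fdd J M X"
    using X J by (intro has_exponent_fdd_eq) auto
qed

text \<open>With both corners equal to \<open>x\<close> the exponent is the total weight of the
  nonempty subsets of \<open>{s, t}\<close> over \<open>x\<close>. The two singleton marginals equal
  1 and count the pair twice, so the total is \<open>2 - m ({s, t}, {s, t})\<close>.\<close>

lemma has_exponent_tail_dependence:
  assumes X: "has_exponent T m M X" and s: "s \<in> T" and t: "t \<in> T"
  shows "tail_dependence M X (s, t) = m ({s, t}, {s, t})"
proof -
  have field: "random_field T M X" using X by (rule has_exponent_field)
  have joint: "\<P>(\<omega> in M. X s \<omega> \<le> x \<and> X t \<omega> \<le> x) = exp (- (2 - m ({s, t}, {s, t})) / x)" if x: "x > 0" for x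
  proof -
    have "\<P>(\<omega> in M. \<forall>u\<in>{s, t}. X u \<omega> \<le> x) = exp (- stable_exponent m {s, t} (\<lambda>_. x))"
      by (rule has_exponentD[OF X]) (use s t x in auto)
    moreover have "stable_exponent m {s, t} (\<lambda>_. x) = (2 - m ({s, t}, {s, t})) / x"
    proof (cases "s = t")
      \<comment> \<open>On the diagonal \<open>{s, t}\<close> is a singleton of weight 1, and the
        coefficient is \<open>2 - 1\<close>.\<close>
      case True
      then show ?thesis using weight_singleton[OF t] by (simp add: stable_exponent_singleton)
    next
      case False
      have Pow: "Pow {s, t} = {{}, {s}, {t}, {s, t}}" by (auto simp: Pow_insert)
      have "{A\<in>Pow {s, t}. A \<inter> {s} = {s}} = {{s}, {s, t}}" "{A\<in>Pow {s, t}. A \<inter> {t} = {t}} = {{t}, {s, t}}"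
        unfolding Pow using False by auto
      moreover have "{s} \<noteq> {s, t}" "{t} \<noteq> {s, t}" using False by auto
      ultimately have ms: "m ({s, t}, {s}) + m ({s, t}, {s, t}) = 1"
        and mt: "m ({s, t}, {t}) + m ({s, t}, {s, t}) = 1"
        using weight_marginal[of "{s, t}" "{s}" "{s}"] weight_marginal[of "{s, t}" "{t}" "{t}"] s t
        by (simp_all add: weight_singleton)
      have "Pow {s, t} - {{}} = {{s}, {t}, {s, t}}" unfolding Pow by auto
      then have "stable_exponent m {s, t} (\<lambda>_. x) = (m ({s, t}, {s}) + m ({s, t}, {t}) + m ({s, t}, {s, t})) / x"
        using False \<open>{s} \<noteq> {s, t}\<close> \<open>{t} \<noteq> {s, t}\<close> by (simp add: stable_exponent_def add_divide_distrib)
      also have "\<dots> = (2 - m ({s, t}, {s, t})) / x" using ms mt by simp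
      finally show ?thesis .
    qed
    ultimately show ?thesis by (simp add: minus_divide_left)
  qed
  have "((\<lambda>x. \<P>(\<omega> in M. X s \<omega> \<ge> x \<bar> X t \<omega> \<ge> x)) \<longlongrightarrow> 2 - (2 - m ({s, t}, {s, t}))) at_top"
    by (rule tendsto_tail_Frechet[OF field has_exponent_Frechet[OF X] s t joint])
  from tendsto_Lim[OF _ this] show ?thesis by (simp add: tail_dependence_def)
qed

text \<open>Each finite \<open>J\<close> has its own spectral model on its own product space. Their
  laws \<open>P J\<close> are projective because restricting the model on \<open>H\<close> to
  \<open>J\<close> keeps the exponent, so the coordinate field under the projective limit has it for
  all finite sets at once.\<close>

lemma ex_has_exponent: "\<exists>M :: ('t \<Rightarrow> real) measure. has_exponent T m M (\<lambda>t f. f t)"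
proof -
  define P where "P J = fdd J (\<Pi>\<^sub>M A\<in>Pow J. Frechet_measure) (spectral_max m J)" for J
  have field: "random_field J (\<Pi>\<^sub>M A\<in>Pow J. Frechet_measure) (spectral_max m J)" if "finite J" "J \<subseteq> T" for J
    using spectral_max_has_exponent[OF that] by (rule has_exponent_field)
  interpret polish_projective T P
  proof (intro polish_projective.intro projective_family.intro)
    show "prob_space (P J)" if "finite J" "J \<subseteq> T" for J
      unfolding P_def using field[OF that] by (rule prob_space_fdd) simp
    fix J H assume JH: "J \<subseteq> H" "finite H" "H \<subseteq> (T :: 't set)"
    then have J: "finite J" "J \<subseteq> T" using finite_subset by auto
    let ?Q = "\<lambda>J. \<Pi>\<^sub>M A\<in>Pow J. Frechet_measure"
    have "distr (P H) (\<Pi>\<^sub>M t\<in>J. borel) (\<lambda>f. restrict f J) = fdd J (?Q H) (spectral_max m H)"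
      unfolding P_def fdd_def using measurable_restrict_field[OF field[OF JH(2,3)] order_refl] JH
      by (subst distr_distr) (auto simp: comp_def restrict_restrict Int_absorb1 measurable_restrict_subset)
    also have "\<dots> = P J"
      unfolding P_def using J JH
      by (intro has_exponent_fdd_eq[OF spectral_max_has_exponent spectral_max_has_exponent]) auto
    finally show "P J = distr (P H) (\<Pi>\<^sub>M t\<in>J. borel) (\<lambda>f. restrict f J)" ..
  qed
  have "has_exponent T m lim (\<lambda>t f. f t)"
    unfolding has_exponent_def
  proof (intro conjI allI impI)
    show "random_field T lim (\<lambda>t f. f t)"
      by (auto simp: random_field_def P.prob_space_axioms cong: measurable_cong_sets)
    fix K a assume "finite K \<and> K \<subseteq> T \<and> (\<forall>t\<in>K. 0 < (a t :: real))"
    then have K: "finite K" "K \<subseteq> T" "\<forall>t\<in>K. 0 < a t" by auto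
    let ?A = "{f\<in>space (\<Pi>\<^sub>M t\<in>K. borel). \<forall>t\<in>K. f t \<le> a t}"
    have "{f\<in>space lim. \<forall>t\<in>K. f t \<le> a t} = emb T K ?A"
      using K by (auto simp: prod_emb_def space_PiM)
    then have "measure lim {f\<in>space lim. \<forall>t\<in>K. f t \<le> a t} = measure (P K) ?A"
      using K by (simp add: measure_def emeasure_lim_emb sets_PiM_Collect_le_finite)
    also have "?A = {f\<in>space (P K). \<forall>t\<in>K. f t \<le> a t}"
      by (simp add: P_def fdd_def)
    also have "measure (P K) \<dots> = exp (- stable_exponent m K a)"
      unfolding P_def prob_fdd_le[OF field[OF K(1,2)] order_refl K(1) order_refl]
      using K by (intro has_exponentD[OF spectral_max_has_exponent]) auto
    finally show "\<P>(f in lim. \<forall>t\<in>K. f t \<le> a t) = exp (- stable_exponent m K a)" .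
  qed
  then show ?thesis by blast
qed

lemma weights_in_Xi_max: "(\<lambda>(s, t)\<in>T \<times> T. m ({s, t}, {s, t})) \<in> Xi_max T"
proof -
  obtain M :: "('t \<Rightarrow> real) measure" where M: "has_exponent T m M (\<lambda>t f. f t)"
    using ex_has_exponent by blast
  have "(\<lambda>(s, t)\<in>T \<times> T. m ({s, t}, {s, t})) = restrict (tail_dependence M (\<lambda>t f. f t)) (T \<times> T)"
    using has_exponent_tail_dependence[OF M] by (auto simp: fun_eq_iff restrict_def)
  moreover have "random_field T M (\<lambda>t f. f t)" using M by (rule has_exponent_field)
  ultimately show ?thesis
    unfolding Xi_max_def using has_exponent_Frechet[OF M] has_exponent_max_stable[OF M] by blast
qed

end

section \<open>Compactness of the set of weights\<close>

lemma compact_consistent_weights: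
  fixes T :: "'t set"
  shows "compact (consistent_weights T)"
proof -
  have 1: "compact (PiE UNIV (\<lambda>_ :: 't set \<times> 't set. {0..1::real}))"
    using compactin_PiE[of "\<lambda>_. euclideanreal" UNIV "\<lambda>_ :: 't set \<times> 't set. {0..1::real}"]
    by (simp add: euclidean_product_topology)
  have 2: "closed {m. (\<Sum>A\<in>S. m (H, A)) = (m p :: real)}" for S and H :: "'t set" and p :: "'t set \<times> 't set"
    by (intro closed_Collect_eq continuous_intros continuous_on_product_coordinates)
  have 3: "closed {m. m p = (1::real)}" for p :: "'t set \<times> 't set"
    by (intro closed_Collect_eq continuous_intros continuous_on_product_coordinates)
  \<comment> \<open>The side conditions do not mention \<open>m\<close>, so the sets they define are
    open, as \<open>closed_Collect_imp\<close> asks of a premise; the equations relate continuous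
    functions of \<open>m\<close>.\<close>
  have "closed {m :: 't set \<times> 't set \<Rightarrow> real. (\<forall>H J B. finite H \<and> J \<subseteq> H \<and> H \<subseteq> T \<and> B \<subseteq> J \<and> B \<noteq> {} \<longrightarrow>
      (\<Sum>A\<in>{A\<in>Pow H. A \<inter> J = B}. m (H, A)) = m (J, B)) \<and> (\<forall>t\<in>T. m ({t}, {t}) = 1)}"
    unfolding Ball_def
    by (intro closed_Collect_conj closed_Collect_all closed_Collect_imp open_Collect_const 2 3)
  from compact_Int_closed[OF 1 this] show ?thesis
    by (rule back_subst[of compact]) (auto simp: consistent_weights_def PiE_def)
qed

text \<open>A continuous image of a compact set in a Hausdorff space is closed. This lets limits of
  binary fields be taken at the level of weights, without constructing a limiting binary
  field.\<close>

lemma closed_weights_image: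
  "closedin (product_topology (\<lambda>_. euclideanreal) (T \<times> T))
    ((\<lambda>m. \<lambda>(s, t)\<in>T \<times> T. m ({s, t}, {s, t})) ` consistent_weights T)"
proof (rule compactin_imp_closedin)
  show "compactin (product_topology (\<lambda>_. euclideanreal) (T \<times> T))
    ((\<lambda>m. \<lambda>(s, t)\<in>T \<times> T. m ({s, t}, {s, t})) ` consistent_weights T)"
  proof (rule image_compactin)
    show "compactin euclidean (consistent_weights T)" by (simp add: compact_consistent_weights)
    show "continuous_map euclidean (product_topology (\<lambda>_. euclideanreal) (T \<times> T))
        (\<lambda>m. \<lambda>(s, t)\<in>T \<times> T. m ({s, t}, {s, t}) :: real)"
      unfolding continuous_map_componentwise by (auto simp: case_prod_unfold)
  qed
qed (simp add: Hausdorff_space_product_topology)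

text \<open>Consistency is additivity: the patterns on \<open>H\<close> that restrict to
  \<open>B\<close> on \<open>J\<close> partition the event of pattern \<open>B\<close> on
  \<open>J\<close>. Division by the common success probability \<open>p\<close> normalises the
  singleton weights to 1.\<close>

lemma Xi_bin_subset_weights_image:
  fixes T :: "'t set"
  shows "Xi_bin T \<subseteq> (\<lambda>m. \<lambda>(s, t)\<in>T \<times> T. m ({s, t}, {s, t})) ` consistent_weights T"
proof
  fix f assume "f \<in> Xi_bin T"
  then obtain M :: "('t \<Rightarrow> real) measure" and Y
    where f: "f = (\<lambda>(s, t)\<in>T \<times> T. \<P>(\<omega> in M. Y s \<omega> = 1 \<bar> Y t \<omega> = 1))"
    and Y: "random_field T M Y" and bin: "\<forall>t\<in>T. \<forall>\<omega>\<in>space M. Y t \<omega> \<in> {0, 1}"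
    and im: "identical_marginals T M Y" and nz: "\<forall>t\<in>T. prob_space.expectation M (Y t) \<noteq> 0"
    unfolding Xi_bin_def by blast
  interpret prob_space M using Y by (simp add: random_field_def)
  have meas: "Y t \<in> borel_measurable M" if "t \<in> T" for t
    using Y that by (simp add: random_field_def)
  obtain p where p: "p > 0" "\<And>t. t \<in> T \<Longrightarrow> \<P>(\<omega> in M. Y t \<omega> = 1) = p"
  proof (cases "T = {}")
    \<comment> \<open>With no sites any positive \<open>p\<close> will do.\<close>
    case True
    then show ?thesis using that[of 1] by auto
  next
    case False
    then obtain t0 where t0: "t0 \<in> T" by blast
    have "\<P>(\<omega> in M. Y t \<omega> = 1) = \<P>(\<omega> in M. Y t0 \<omega> = 1)" if t: "t \<in> T" for t
    proof -
      have "\<P>(\<omega> in M. Y u \<omega> = 1) = measure (distr M borel (Y u)) {1}" if "u \<in> T" for u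
        using meas[OF that] by (auto simp: measure_distr intro!: arg_cong[of _ _ prob])
      moreover have "distr M borel (Y t) = distr M borel (Y t0)"
        using im t t0 unfolding identical_marginals_def by blast
      ultimately show ?thesis using t t0 by simp
    qed
    moreover have "\<P>(\<omega> in M. Y t0 \<omega> = 1) > 0"
    proof -
      note [measurable] = meas[OF t0]
      have "expectation (Y t0) = expectation (indicator {\<omega>\<in>space M. Y t0 \<omega> = 1})"
        using bin t0 by (intro Bochner_Integration.integral_cong) (auto simp: indicator_def)
      also have "\<dots> = \<P>(\<omega> in M. Y t0 \<omega> = 1)" by simp
      finally show ?thesis using bspec[OF nz t0] by (simp add: zero_less_measure_iff)
    qed
    ultimately show ?thesis using that by blast
  qed
  define E where "E J B = {\<omega>\<in>space M. \<forall>t\<in>J. Y t \<omega> = 1 \<longleftrightarrow> t \<in> B}" for J B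
  have E_sets: "E J B \<in> sets M" if "finite J" "J \<subseteq> T" for J B
    unfolding E_def
  proof (rule sets.sets_Collect_finite_All)
    fix t assume "t \<in> J"
    then have [measurable]: "Y t \<in> borel_measurable M" using that meas by auto
    show "{\<omega>\<in>space M. Y t \<omega> = 1 \<longleftrightarrow> t \<in> B} \<in> sets M" by measurable
  qed (use that in auto)
  \<comment> \<open>The default 0 keeps all remaining entries in \<open>[0, 1]\<close>. It covers
    the empty pattern, whose probability over \<open>p\<close> may exceed 1.\<close>
  define m where "m = (\<lambda>(J, B). if finite J \<and> J \<subseteq> T \<and> B \<subseteq> J \<and> B \<noteq> {} then prob (E J B) / p else 0)"
  have "m q \<in> {0..1}" for q
  proof (cases q)
    case (Pair J B)
    show ?thesis
    proof (cases "finite J \<and> J \<subseteq> T \<and> B \<subseteq> J \<and> B \<noteq> {}")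
      case True
      \<comment> \<open>A site \<open>b\<close> of the nonempty pattern bounds the event by
        \<open>Y b \<omega> = 1\<close>, of probability \<open>p\<close>, so the weight is at most
        1.\<close>
      then obtain b where b: "b \<in> B" "b \<in> J" "b \<in> T" by blast
      note [measurable] = meas[OF b(3)]
      have "prob (E J B) \<le> \<P>(\<omega> in M. Y b \<omega> = 1)"
        using b by (intro finite_measure_mono) (auto simp: E_def)
      then show ?thesis using p b by (simp add: Pair m_def)
    next
      case False
      then have "m q = 0" unfolding Pair m_def prod.case by (rule if_not_P)
      then show ?thesis by simp
    qed
  qed
  moreover have "(\<Sum>A\<in>{A\<in>Pow H. A \<inter> J = B}. m (H, A)) = m (J, B)"
    if "finite H" "J \<subseteq> H" "H \<subseteq> T" "B \<subseteq> J" "B \<noteq> {}" for H J B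
  proof -
    have "finite J" using that finite_subset by blast
    have "(\<Sum>A\<in>{A\<in>Pow H. A \<inter> J = B}. m (H, A)) = (\<Sum>A\<in>{A\<in>Pow H. A \<inter> J = B}. prob (E H A)) / p"
      unfolding sum_divide_distrib using that by (intro sum.cong) (auto simp: m_def)
    also have "(\<Sum>A\<in>{A\<in>Pow H. A \<inter> J = B}. prob (E H A)) = prob (\<Union>A\<in>{A\<in>Pow H. A \<inter> J = B}. E H A)"
    proof (rule finite_measure_finite_Union[symmetric])
      show "disjoint_family_on (E H) {A\<in>Pow H. A \<inter> J = B}"
        by (fastforce simp: disjoint_family_on_def E_def)
    qed (use that E_sets in auto)
    also have "(\<Union>A\<in>{A\<in>Pow H. A \<inter> J = B}. E H A) = E J B"
    proof safe
      \<comment> \<open>The pattern on \<open>H\<close> to which \<omega> belongs is the set of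
        sites in \<open>H\<close> where \<open>Y\<close> equals 1.\<close>
      fix \<omega> assume "\<omega> \<in> E J B"
      then have "{t\<in>H. Y t \<omega> = 1} \<in> {A\<in>Pow H. A \<inter> J = B}" "\<omega> \<in> E H {t\<in>H. Y t \<omega> = 1}"
        using that by (auto simp: E_def)
      then show "\<omega> \<in> (\<Union>A\<in>{A\<in>Pow H. A \<inter> J = B}. E H A)" by blast
    qed (use that in \<open>auto simp: E_def\<close>)
    finally show ?thesis using that \<open>finite J\<close> by (auto simp: m_def)
  qed
  moreover have "m ({t}, {t}) = 1" if "t \<in> T" for t
    using that p by (simp add: m_def E_def)
  ultimately have "m \<in> consistent_weights T"
    unfolding consistent_weights_def by blast
  moreover have "f = (\<lambda>(s, t)\<in>T \<times> T. m ({s, t}, {s, t}))"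
    using p by (auto simp: f m_def E_def cond_prob_def fun_eq_iff restrict_def)
  ultimately show "f \<in> (\<lambda>m. \<lambda>(s, t)\<in>T \<times> T. m ({s, t}, {s, t})) ` consistent_weights T" by blast
qed

lemma closure_Xi_bin_subset_Xi_max: "pointwise_closure T (Xi_bin T) \<subseteq> Xi_max T"
proof -
  have "pointwise_closure T (Xi_bin T) \<subseteq>
      (\<lambda>m. \<lambda>(s, t)\<in>T \<times> T. m ({s, t}, {s, t})) ` consistent_weights T"
    by (intro closure_of_minimal Xi_bin_subset_weights_image closed_weights_image)
  also have "\<dots> \<subseteq> Xi_max T" using weights_in_Xi_max by blast
  finally show ?thesis .
qed

theorem proposition23:
  fixes T :: "'t set"
  shows "(Xi_bin T \<subseteq> Xi_max T \<and> Xi_max T \<subseteq> Xi_lim T) \<and>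
    (Xi_lim T = pointwise_closure T (Xi_bin T) \<and>
     pointwise_closure T (Xi_bin T) = pointwise_closure T (Xi_max T)) \<and>
    (\<forall>m :: 't metric. mspace m = T \<and> separable_space (mtopology_of m) \<longrightarrow>
       {f \<in> Xi_max T. continuous_map (prod_topology (mtopology_of m) (mtopology_of m)) euclideanreal f} =
       {f \<in> Xi_lim T. continuous_map (prod_topology (mtopology_of m) (mtopology_of m)) euclideanreal f})"
proof -
  \<comment> \<open>The inclusions close a cycle from \<open>Xi_max\<close> through
    \<open>Xi_lim\<close> and the closure of \<open>Xi_bin\<close> back to \<open>Xi_max\<close>, so
    all three sets coincide.\<close>
  have lim: "Xi_lim T = pointwise_closure T (Xi_bin T)" and max: "Xi_max T = pointwise_closure T (Xi_bin T)"
    using Xi_max_subset_Xi_lim[of T] Xi_lim_subset_closure_Xi_bin[of T] closure_Xi_bin_subset_Xi_max[of T]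
    by auto
  have "Xi_bin T \<subseteq> Xi_max T"
    unfolding max by (rule closure_of_subset[OF Xi_bin_subset_topspace])
  then show ?thesis
    unfolding lim max by (simp add: closure_of_closure_of)
qed

end
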